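(* Let $u$ be a harmonic function in the open upper half-plane $\mathbb{H}$ which is of temperate growth at infinity. Assume that (1) $u(z)\to 0$ as $\mathbb{H}\ni z\to x$ for every $x\in\mathbb{R}$; and (2) $\displaystyle\lim_{t\to+\infty}u(te^{i\theta})/t=0$ for some $0<\theta<\pi$ which is not a rational multiple of $\pi$. Then $u(z)=0$ for all $z\in\mathbb{H}$.
   Context: $\mathbb{H}=\{z\in\mathbb{C}:\operatorname{Im} z>0\}$ is the open upper half-plane. Harmonic functions are complex-valued $C^2$ functions annihilated by the usual Laplacian. A function $u$ in $\mathbb{H}$ is of temperate growth at infinity if there are positive constants $C,R,N$ such that $|u(z)|\leq C\,(|z|^2/\operatorname{Im} z)^N$ for all $z\in\mathbb{H}$ with $|z|>R$. *)

theory Defs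
  imports "HOL-Analysis.Analysis"
begin

definition upper_half_plane :: "complex set" where
  "upper_half_plane = {z. Im z > 0}"

text \<open>
  Throughout, \<open>\<complex>\<close> is the real plane: differentiability is real (Frechet) differentiability, and
  the derivatives are taken at interior points, so the set \<open>S\<close> below is meant to be open.
\<close>

definition partial_deriv :: "complex \<Rightarrow> (complex \<Rightarrow> complex) \<Rightarrow> complex \<Rightarrow> complex" where
  "partial_deriv v u z = frechet_derivative u (at z) v"

definition C1_on :: "complex set \<Rightarrow> (complex \<Rightarrow> complex) \<Rightarrow> bool" where
  "C1_on S u \<longleftrightarrow> (\<forall>z\<in>S. u differentiable (at z)) \<and>
     continuous_on S (partial_deriv 1 u) \<and> continuous_on S (partial_deriv \<i> u)"

definition C2_on :: "complex set \<Rightarrow> (complex \<Rightarrow> complex) \<Rightarrow> bool" where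
  "C2_on S u \<longleftrightarrow> C1_on S u \<and> C1_on S (partial_deriv 1 u) \<and> C1_on S (partial_deriv \<i> u)"

text \<open>The directions \<open>1\<close> and \<open>\<i>\<close> are the coordinate directions of \<open>x\<close> and \<open>y\<close> in \<open>z = x + \<i> y\<close>.\<close>

definition laplacian :: "(complex \<Rightarrow> complex) \<Rightarrow> complex \<Rightarrow> complex" where
  "laplacian u z = partial_deriv 1 (partial_deriv 1 u) z + partial_deriv \<i> (partial_deriv \<i> u) z"

definition harmonic_on :: "complex set \<Rightarrow> (complex \<Rightarrow> complex) \<Rightarrow> bool" where
  "harmonic_on S u \<longleftrightarrow> C2_on S u \<and> (\<forall>z\<in>S. laplacian u z = 0)"

text \<open>The exponent \<open>N\<close> is an arbitrary positive real; the base of the power is positive.\<close>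

definition temperate_at_infinity :: "(complex \<Rightarrow> complex) \<Rightarrow> bool" where
  "temperate_at_infinity u \<longleftrightarrow>
     (\<exists>C R N :: real. C > 0 \<and> R > 0 \<and> N > 0 \<and>
        (\<forall>z\<in>upper_half_plane. cmod z > R \<longrightarrow>
           cmod (u z) \<le> C * ((cmod z)\<^sup>2 / Im z) powr N))"

end

(*
  The real or imaginary part of u, extended by 0 to the real axis, is a real function v which is
  harmonic in the half-plane and vanishes on its boundary. On each half circle |z| = r it is a
  uniform limit of sine polynomials, that is, of imaginary parts of polynomials with real
  coefficients, and by the maximum principle the approximation persists on the whole half disc.
  Hence the j-th sine coefficient of v on the half circle of radius r is a constant times r^j.
  The growth condition blows up at the real axis, but testing v against sin(t)^(2K) sin(mt), which
  is itself a sine polynomial, shows that almost all of these constants vanish. So v is the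
  imaginary part of a polynomial, v = sum_j c_j r^j sin(jt), and the decay along a ray whose angle
  is an irrational multiple of pi, where sin(j theta) is never 0, forces every c_j to be 0.
*)
theory Submission
  imports Defs "HOL-Computational_Algebra.Polynomial"
begin

section \<open>Imaginary parts of real polynomials\<close>

text \<open>These are the model solutions: the imaginary part of a polynomial is harmonic, and real
  coefficients make it vanish on the real axis.\<close>

definition Im_poly :: "real poly \<Rightarrow> complex \<Rightarrow> real" where
  "Im_poly p z = Im (poly (map_poly of_real p) z)"

lemma map_poly_of_real_add:
  "map_poly complex_of_real (p + q) = map_poly of_real p + map_poly of_real q"
  by (intro poly_eqI) (simp add: coeff_map_poly)

lemma map_poly_of_real_mult:
  "map_poly complex_of_real (p * q) = map_poly of_real p * map_poly of_real q"
  by (intro poly_eqI) (simp add: coeff_map_poly coeff_mult)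

lemma map_poly_of_real_power:
  "map_poly complex_of_real (p ^ n) = map_poly of_real p ^ n"
  by (induction n) (simp_all add: map_poly_of_real_mult)

lemma map_poly_of_real_pcompose:
  "map_poly complex_of_real (pcompose p q) = pcompose (map_poly of_real p) (map_poly of_real q)"
  by (induction p)
    (simp_all add: pcompose_pCons map_poly_of_real_add map_poly_of_real_mult map_poly_pCons)

lemma Im_poly_add: "Im_poly (p + q) z = Im_poly p z + Im_poly q z"
  by (simp add: Im_poly_def map_poly_of_real_add)

lemma Im_poly_smult: "Im_poly (smult c p) z = c * Im_poly p z"
  by (simp add: Im_poly_def map_poly_smult)

lemma Im_poly_of_real: "Im_poly p (of_real x) = 0"
  by (simp add: Im_poly_def poly_altdef coeff_map_poly flip: of_real_power)

lemma continuous_on_Im_poly: "continuous_on S (Im_poly p)"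
  unfolding Im_poly_def by (intro continuous_intros)

text \<open>By De Moivre, real coefficients leave only sines, so on a half circle one gets a sine
  polynomial whose \<open>j\<close>-th coefficient scales like \<open>r ^ j\<close>. The constant
  coefficient is invisible here.\<close>

lemma Im_poly_polar:
  "Im_poly p (of_real r * cis t) = (\<Sum>j\<le>degree p. coeff p j * r ^ j * sin (real j * t))"
proof -
  have "degree (map_poly complex_of_real p) = degree p"
    by (rule degree_map_poly) auto
  then show ?thesis
    unfolding Im_poly_def poly_altdef
    by (simp add: coeff_map_poly power_mult_distrib DeMoivre Complex.DeMoivre mult.assoc
        flip: of_real_power of_real_mult)
qed

section \<open>Growth of real polynomials and orthogonality of sines\<close>

lemma poly_div_power_tendsto_lead_coeff:
  fixes p :: "real poly"
  shows "((\<lambda>x. poly p x / x ^ degree p) \<longlongrightarrow> lead_coeff p) at_top"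
  using filterlim_mono[OF poly_divide_tendsto_aux[of p] order_refl at_top_le_at_infinity] .

text \<open>Were the degree larger than \<open>K\<close>, dividing the bound by
  \<open>x ^ degree p\<close> would send the leading coefficient to 0.\<close>

lemma coeff_eq_0_of_poly_bound:
  fixes p :: "real poly"
  assumes bound: "\<And>x. x > R \<Longrightarrow> \<bar>poly p x\<bar> \<le> C * x ^ K" and "j > K"
  shows "coeff p j = 0"
proof -
  have "degree p \<le> K"
  proof (rule ccontr)
    assume "\<not> degree p \<le> K"
    then have d: "degree p > K" by simp
    have "((\<lambda>x. poly p x / x ^ degree p) \<longlongrightarrow> 0) at_top"
    proof (rule Lim_null_comparison)
      have "((\<lambda>x. C * inverse (x ^ (degree p - K))) \<longlongrightarrow> C * 0) at_top"
        using d by (intro tendsto_intros tendsto_inverse_0_at_top filterlim_pow_at_top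
            filterlim_ident) auto
      then show "((\<lambda>x. C * inverse (x ^ (degree p - K))) \<longlongrightarrow> 0) at_top" by simp
      show "\<forall>\<^sub>F x in at_top. norm (poly p x / x ^ degree p) \<le> C * inverse (x ^ (degree p - K))"
        using eventually_gt_at_top[of "max R 0"]
      proof eventually_elim
        case (elim x)
        then have "\<bar>poly p x\<bar> / x ^ degree p \<le> C * x ^ K / x ^ degree p"
          by (intro divide_right_mono bound) auto
        also have "\<dots> = C * inverse (x ^ (degree p - K))"
          using elim d by (simp add: power_diff field_simps)
        finally show ?case using elim by (simp add: abs_div)
      qed
    qed
    then have "lead_coeff p = 0"
      using poly_div_power_tendsto_lead_coeff[of p] tendsto_unique trivial_limit_at_top_linorder
      by blast
    then show False using d by simp
  qed
  then show ?thesis using \<open>j > K\<close> by (simp add: coeff_eq_0)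
qed

text \<open>Explicit antiderivatives from the product formulas. The assumption \<open>j > 0\<close>
  excludes \<open>j = k = 0\<close>, where the integral is 0 and not \<open>pi / 2\<close>.\<close>

lemma sin_mult_integral:
  fixes j k :: nat
  assumes "j > 0"
  shows "integral {0..pi} (\<lambda>t. sin (real j * t) * sin (real k * t)) = (if j = k then pi / 2 else 0)"
proof (cases "j = k")
  case True
  have "((\<lambda>t. sin (real j * t) * sin (real j * t)) has_integral
      (pi / 2 - sin (2 * real j * pi) / (4 * real j)) - (0 / 2 - sin (2 * real j * 0) / (4 * real j))) {0..pi}"
  proof (rule fundamental_theorem_of_calculus)
    fix t :: real
    have "((\<lambda>t. t / 2 - sin (2 * real j * t) / (4 * real j)) has_real_derivative
        1 / 2 - cos (2 * real j * t) / 2) (at t within {0..pi})"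
      using assms by (auto intro!: derivative_eq_intros simp: field_simps)
    also have "1 / 2 - cos (2 * real j * t) / 2 = sin (real j * t) * sin (real j * t)"
      using cos_double_sin[of "real j * t"] by (simp add: mult.assoc power2_eq_square diff_divide_distrib)
    finally show "((\<lambda>t. t / 2 - sin (2 * real j * t) / (4 * real j)) has_vector_derivative
        sin (real j * t) * sin (real j * t)) (at t within {0..pi})"
      by (simp add: has_real_derivative_iff_has_vector_derivative)
  qed auto
  moreover have "sin (2 * real j * pi) = 0"
    using sin_npi[of "2 * j"] by simp
  ultimately show ?thesis using True by (simp add: integral_unique)
next
  case False
  define a b where "a = real j - real k" and "b = real j + real k"
  have nz: "a \<noteq> 0" "b \<noteq> 0" using assms False by (auto simp: a_def b_def)
  define F where "F = (\<lambda>t. sin (a * t) / (2 * a) - sin (b * t) / (2 * b))"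
  have "((\<lambda>t. sin (real j * t) * sin (real k * t)) has_integral F pi - F 0) {0..pi}"
  proof (rule fundamental_theorem_of_calculus)
    fix t :: real
    have "(F has_real_derivative cos (a * t) / 2 - cos (b * t) / 2) (at t within {0..pi})"
      unfolding F_def using nz by (auto intro!: derivative_eq_intros simp: field_simps)
    also have "cos (a * t) / 2 - cos (b * t) / 2 = sin (real j * t) * sin (real k * t)"
      by (simp add: a_def b_def sin_times_sin left_diff_distrib distrib_right diff_divide_distrib)
    finally show "(F has_vector_derivative sin (real j * t) * sin (real k * t)) (at t within {0..pi})"
      by (simp add: has_real_derivative_iff_has_vector_derivative)
  qed auto
  moreover have "sin (a * pi) = 0" "sin (b * pi) = 0"
    unfolding a_def b_def ring_distribs sin_add sin_diff by (simp_all add: sin_npi)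
  ultimately show ?thesis using False by (simp add: F_def integral_unique)
qed

section \<open>The maximum principle on half discs\<close>

text \<open>Harmonicity at \<open>z\<close> in terms of one-variable derivatives along the two
  coordinate lines: what the maximum principle tests, in a form stable under differences. The range
  \<open>\<bar>t\<bar> < Im z\<close> keeps the vertical segment in the open half-plane.\<close>

definition line_laplace :: "(complex \<Rightarrow> real) \<Rightarrow> complex \<Rightarrow> bool" where
  "line_laplace v z \<longleftrightarrow> (\<exists>g h a b.
     (\<forall>t. \<bar>t\<bar> < Im z \<longrightarrow> ((\<lambda>t. v (z + of_real t)) has_real_derivative g t) (at t)) \<and>
     (\<forall>t. \<bar>t\<bar> < Im z \<longrightarrow> ((\<lambda>t. v (z + \<i> * of_real t)) has_real_derivative h t) (at t)) \<and>
     (g has_real_derivative a) (at 0) \<and> (h has_real_derivative b) (at 0) \<and> a + b = 0)"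

lemma line_laplace_diff:
  assumes "line_laplace v z" "line_laplace w z"
  shows "line_laplace (\<lambda>z. v z - w z) z"
proof -
  obtain g h a b where v:
    "\<And>t. \<bar>t\<bar> < Im z \<Longrightarrow> ((\<lambda>t. v (z + of_real t)) has_real_derivative g t) (at t)"
    "\<And>t. \<bar>t\<bar> < Im z \<Longrightarrow> ((\<lambda>t. v (z + \<i> * of_real t)) has_real_derivative h t) (at t)"
    "(g has_real_derivative a) (at 0)" "(h has_real_derivative b) (at 0)" "a + b = 0"
    using assms(1) unfolding line_laplace_def by blast
  obtain g' h' a' b' where w:
    "\<And>t. \<bar>t\<bar> < Im z \<Longrightarrow> ((\<lambda>t. w (z + of_real t)) has_real_derivative g' t) (at t)"
    "\<And>t. \<bar>t\<bar> < Im z \<Longrightarrow> ((\<lambda>t. w (z + \<i> * of_real t)) has_real_derivative h' t) (at t)"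
    "(g' has_real_derivative a') (at 0)" "(h' has_real_derivative b') (at 0)" "a' + b' = 0"
    using assms(2) unfolding line_laplace_def by blast
  show ?thesis
    unfolding line_laplace_def
    using v w
    by (intro exI[of _ "\<lambda>t. g t - g' t"] exI[of _ "\<lambda>t. h t - h' t"]
        exI[of _ "a - a'"] exI[of _ "b - b'"]) (auto intro!: DERIV_diff)
qed

text \<open>Differentiating a holomorphic function twice in direction \<open>d\<close> produces the
  factor \<open>d * d\<close>, and the factors for 1 and \<open>\<i>\<close> cancel.\<close>

lemma line_laplace_Im_poly: "line_laplace (Im_poly p) z"
proof -
  define P where "P = map_poly complex_of_real p"
  \<comment> \<open>The factor \<open>c\<close> and the free \<open>Q\<close> allow a second
    application, to the first derivative \<open>\<i> * poly (pderiv P)\<close>.\<close>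
  have der: "((\<lambda>t::real. Im (c * poly Q (z + d * of_real t))) has_real_derivative
      Im (c * d * poly (pderiv Q) (z + d * of_real t))) (at t)" for c d Q t
  proof -
    have "((\<lambda>w. c * poly Q (z + d * w)) has_field_derivative
        c * (poly (pderiv Q) (z + d * of_real t) * d)) (at (of_real t))"
      by (auto intro!: derivative_eq_intros DERIV_chain'[where g = "poly Q"] poly_DERIV)
    then have "((\<lambda>t::real. c * poly Q (z + d * of_real t)) has_vector_derivative
        c * (poly (pderiv Q) (z + d * of_real t) * d)) (at t)"
      by (rule has_vector_derivative_real_field)
    from bounded_linear.has_vector_derivative[OF bounded_linear_Im this] show ?thesis
      by (simp add: has_real_derivative_iff_has_vector_derivative mult_ac)
  qed
  have "((\<lambda>t. Im_poly p (z + of_real t)) has_real_derivative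
      Im (poly (pderiv P) (z + of_real t))) (at t)" for t
    using der[of 1 P 1 t] by (simp add: Im_poly_def P_def)
  moreover have "((\<lambda>t. Im_poly p (z + \<i> * of_real t)) has_real_derivative
      Im (\<i> * poly (pderiv P) (z + \<i> * of_real t))) (at t)" for t
    using der[of 1 P \<i> t] by (simp add: Im_poly_def P_def)
  moreover have "((\<lambda>t. Im (poly (pderiv P) (z + of_real t))) has_real_derivative
      Im (poly (pderiv (pderiv P)) z)) (at 0)"
    using der[of 1 "pderiv P" 1 0] by simp
  moreover have "((\<lambda>t. Im (\<i> * poly (pderiv P) (z + \<i> * of_real t))) has_real_derivative
      - Im (poly (pderiv (pderiv P)) z)) (at 0)"
    using der[of \<i> "pderiv P" \<i> 0] by simp
  ultimately show ?thesis
    unfolding line_laplace_def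
    by (intro exI[of _ "\<lambda>t. Im (poly (pderiv P) (z + of_real t))"]
        exI[of _ "\<lambda>t. Im (\<i> * poly (pderiv P) (z + \<i> * of_real t))"]
        exI[of _ "Im (poly (pderiv (pderiv P)) z)"] exI[of _ "- Im (poly (pderiv (pderiv P)) z)"]) auto
qed

text \<open>If \<open>D > 0\<close>, then \<open>g\<close>, which vanishes at the maximum, is
  positive just to its right, and the mean value theorem makes \<open>f\<close> exceed
  \<open>f 0\<close> there.\<close>

lemma second_derivative_at_local_max:
  fixes f g :: "real \<Rightarrow> real"
  assumes "d > 0"
    and f: "\<And>t. \<bar>t\<bar> < d \<Longrightarrow> (f has_real_derivative g t) (at t)"
    and g: "(g has_real_derivative D) (at 0)"
    and max: "\<And>t. \<bar>t\<bar> < d \<Longrightarrow> f t \<le> f 0"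
  shows "D \<le> 0"
proof (rule ccontr)
  assume "\<not> D \<le> 0"
  then obtain e where e: "e > 0" "\<And>h. 0 < h \<Longrightarrow> h < e \<Longrightarrow> g 0 < g (0 + h)"
    using DERIV_pos_inc_right[OF g] by auto
  have "g 0 = 0"
    using DERIV_local_max[OF f[of 0] \<open>d > 0\<close>] max \<open>d > 0\<close> by simp
  define s where "s = min d e / 2"
  have s: "0 < s" "s < d" "s < e" using e(1) \<open>d > 0\<close> by (auto simp: s_def)
  obtain t where t: "0 < t" "t < s" "f s - f 0 = (s - 0) * g t"
    using MVT2[OF s(1), of f g] f s by force
  have "g t > 0" using e(2)[of t] t s \<open>g 0 = 0\<close> by simp
  then have "f s > f 0" using t s by (simp add: algebra_simps)
  then show False using max[of s] s by simp
qed

text \<open>Adding \<open>\<delta>\<bar>z\<bar>\<^sup>2\<close> makes the Laplacian strictly positive, which rules out an interior maximum.\<close>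

lemma half_disc_max_principle:
  fixes v :: "complex \<Rightarrow> real"
  assumes cont: "continuous_on {z. 0 \<le> Im z} v"
    and harm: "\<And>z. 0 < Im z \<Longrightarrow> line_laplace v z"
    and real: "\<And>x. v (of_real x) \<le> M"
    and circle: "\<And>z. 0 \<le> Im z \<Longrightarrow> cmod z = r \<Longrightarrow> v z \<le> M"
    and z: "0 \<le> Im z" "cmod z \<le> r"
  shows "v z \<le> M"
proof (rule field_le_epsilon)
  fix e :: real
  assume "e > 0"
  \<comment> \<open>The perturbation costs at most \<open>e\<close> on the half disc; the
    \<open>+ 1\<close> keeps the denominator positive.\<close>
  define d where "d = e / (r\<^sup>2 + 1)"
  have d: "d > 0" "d * r\<^sup>2 \<le> e"
    using \<open>e > 0\<close> by (auto simp: d_def field_simps add_pos_nonneg)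
  define K where "K = cball 0 r \<inter> {z. 0 \<le> Im z}"
  have "compact K"
    unfolding K_def by (intro compact_Int_closed compact_cball closed_halfspace_Im_ge)
  moreover have "z \<in> K" using z by (simp add: K_def)
  moreover have "continuous_on K (\<lambda>z. v z + d * (cmod z)\<^sup>2)"
    by (intro continuous_intros continuous_on_subset[OF cont]) (auto simp: K_def)
  ultimately obtain m where m: "m \<in> K"
    "\<And>y. y \<in> K \<Longrightarrow> v y + d * (cmod y)\<^sup>2 \<le> v m + d * (cmod m)\<^sup>2"
    using continuous_attains_sup[of K] by blast
  have "v m \<le> M"
  proof (cases "Im m = 0 \<or> cmod m = r")
    case True
    then show ?thesis
      using circle[of m] real[of "Re m"] m(1) complex_eq_iff[of "of_real (Re m)" m]
      by (auto simp: K_def)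
  next
    case False
    then have "0 < Im m" "cmod m < r" using m(1) by (auto simp: K_def)
    then obtain g h a b where D:
      "\<And>t. \<bar>t\<bar> < Im m \<Longrightarrow> ((\<lambda>t. v (m + of_real t)) has_real_derivative g t) (at t)"
      "\<And>t. \<bar>t\<bar> < Im m \<Longrightarrow> ((\<lambda>t. v (m + \<i> * of_real t)) has_real_derivative h t) (at t)"
      "(g has_real_derivative a) (at 0)" "(h has_real_derivative b) (at 0)" "a + b = 0"
      using harm[of m] unfolding line_laplace_def by blast
    \<comment> \<open>Within distance \<open>s\<close> of \<open>m\<close> both coordinate lines
      stay inside the half disc, where \<open>m\<close> is the maximum.\<close>
    define s where "s = min (Im m) (r - cmod m)"
    have s: "s > 0" "s \<le> Im m" using \<open>0 < Im m\<close> \<open>cmod m < r\<close> by (auto simp: s_def)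
    have inK: "m + c * of_real t \<in> K" if "\<bar>t\<bar> < s" "cmod c = 1" for t c
    proof -
      have "cmod (c * of_real t) < s" using that by (simp add: norm_mult)
      moreover have "\<bar>Im (c * of_real t)\<bar> \<le> cmod (c * of_real t)" by (rule abs_Im_le_cmod)
      ultimately show ?thesis
        using norm_triangle_ineq[of m "c * of_real t"] by (auto simp: K_def s_def)
    qed
    have sq: "(cmod (m + of_real t))\<^sup>2 = (Re m + t)\<^sup>2 + (Im m)\<^sup>2"
      "(cmod (m + \<i> * of_real t))\<^sup>2 = (Re m)\<^sup>2 + (Im m + t)\<^sup>2" for t
      by (simp_all add: cmod_power2)
    \<comment> \<open>Along either line the perturbation has second derivative \<open>2 * d\<close>.
      Adding the two inequalities gives \<open>a + b + 4 * d \<le> 0\<close>, against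
      \<open>a + b = 0\<close>.\<close>
    have "a + 2 * d \<le> 0"
    proof (rule second_derivative_at_local_max[OF \<open>s > 0\<close>])
      fix t :: real assume t: "\<bar>t\<bar> < s"
      show "((\<lambda>t. v (m + of_real t) + d * ((Re m + t)\<^sup>2 + (Im m)\<^sup>2)) has_real_derivative
          g t + 2 * d * (Re m + t)) (at t)"
        using D(1)[of t] s t by (auto intro!: derivative_eq_intros)
      show "v (m + of_real t) + d * ((Re m + t)\<^sup>2 + (Im m)\<^sup>2)
          \<le> v (m + of_real 0) + d * ((Re m + 0)\<^sup>2 + (Im m)\<^sup>2)"
        using m(2)[OF inK[OF t, of 1]] sq(1)[of t] sq(1)[of 0] by simp
    qed (use D(3) in \<open>auto intro!: derivative_eq_intros\<close>)
    moreover have "b + 2 * d \<le> 0"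
    proof (rule second_derivative_at_local_max[OF \<open>s > 0\<close>])
      fix t :: real assume t: "\<bar>t\<bar> < s"
      show "((\<lambda>t. v (m + \<i> * of_real t) + d * ((Re m)\<^sup>2 + (Im m + t)\<^sup>2)) has_real_derivative
          h t + 2 * d * (Im m + t)) (at t)"
        using D(2)[of t] s t by (auto intro!: derivative_eq_intros)
      show "v (m + \<i> * of_real t) + d * ((Re m)\<^sup>2 + (Im m + t)\<^sup>2)
          \<le> v (m + \<i> * of_real 0) + d * ((Re m)\<^sup>2 + (Im m + 0)\<^sup>2)"
        using m(2)[OF inK[OF t, of \<i>]] sq(2)[of t] sq(2)[of 0] by simp
    qed (use D(4) in \<open>auto intro!: derivative_eq_intros\<close>)
    ultimately show ?thesis using D(5) d by simp
  qed
  moreover have "v z \<le> v m + d * (cmod m)\<^sup>2"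
  proof -
    have "0 \<le> d * (cmod z)\<^sup>2" using d by simp
    then show ?thesis using m(2)[OF \<open>z \<in> K\<close>] by linarith
  qed
  moreover have "d * (cmod m)\<^sup>2 \<le> e"
  proof -
    have "(cmod m)\<^sup>2 \<le> r\<^sup>2"
      using m(1) by (intro power_mono) (auto simp: K_def)
    then show ?thesis using d mult_left_mono[of "(cmod m)\<^sup>2" "r\<^sup>2" d] by linarith
  qed
  ultimately show "v z \<le> M + e" by linarith
qed

section \<open>Approximation by imaginary parts of polynomials\<close>

definition dirichlet_harmonic :: "(complex \<Rightarrow> real) \<Rightarrow> bool" where
  "dirichlet_harmonic v \<longleftrightarrow> continuous_on {z. 0 \<le> Im z} v \<and> (\<forall>x. v (of_real x) = 0) \<and>
     (\<forall>z. 0 < Im z \<longrightarrow> line_laplace v z)"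

lemma dirichlet_harmonic_Im_poly: "dirichlet_harmonic (Im_poly p)"
  by (auto simp: dirichlet_harmonic_def continuous_on_Im_poly Im_poly_of_real line_laplace_Im_poly)

lemma dirichlet_harmonic_diff:
  assumes "dirichlet_harmonic v" "dirichlet_harmonic w"
  shows "dirichlet_harmonic (\<lambda>z. v z - w z)"
  using assms by (auto simp: dirichlet_harmonic_def line_laplace_diff intro!: continuous_intros)

lemma half_disc_abs_bound:
  assumes v: "dirichlet_harmonic v"
    and circle: "\<And>z. 0 \<le> Im z \<Longrightarrow> cmod z = r \<Longrightarrow> \<bar>v z\<bar> \<le> M" and "0 \<le> M"
    and z: "0 \<le> Im z" "cmod z \<le> r"
  shows "\<bar>v z\<bar> \<le> M"
proof -
  have "v z \<le> M"
    using half_disc_max_principle[of v M r z] assms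
    unfolding dirichlet_harmonic_def by (auto simp: abs_le_iff)
  \<comment> \<open>The negative of \<open>v\<close> is written as a difference from the zero
    polynomial, so that closure under differences applies.\<close>
  have neg: "dirichlet_harmonic (\<lambda>z. Im_poly 0 z - v z)"
    by (intro dirichlet_harmonic_diff dirichlet_harmonic_Im_poly v)
  have "Im_poly 0 z - v z \<le> M"
  proof (rule half_disc_max_principle[of _ M r])
    fix z assume "0 \<le> Im z" "cmod z = r"
    then show "Im_poly 0 z - v z \<le> M" using circle[of z] by (simp add: Im_poly_def)
  qed (use neg z \<open>0 \<le> M\<close> in \<open>auto simp: dirichlet_harmonic_def\<close>)
  with \<open>v z \<le> M\<close> show ?thesis by (simp add: Im_poly_def abs_le_iff)
qed

section \<open>Uniform approximation on a half circle by sine polynomials\<close>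

lemma half_circle_polar:
  assumes "0 \<le> Im z"
  obtains t where "0 \<le> t" "t \<le> pi" "z = of_real (cmod z) * cis t"
proof -
  have "z = of_real (cmod z) * cis (Arg z)"
    using rcis_cmod_Arg[of z] by (simp add: rcis_def)
  moreover have "0 \<le> Arg z" using assms by (simp add: Arg_less_0)
  ultimately show thesis using that Arg_le_pi by blast
qed

text \<open>For \<open>p = pCons a p'\<close> the real constant \<open>a\<close> contributes
  nothing, and \<open>cos t * cis t = (1 + cis t * cis t) / 2\<close> turns the rest into half of
  \<open>p'\<close> plus \<open>p'\<close> shifted by two degrees.\<close>

lemma Im_poly_cos_mult:
  obtains q where "\<And>t. Im_poly q (cis t) = cos t * Im_poly p (cis t)"
proof (cases p)
  case (pCons a p')
  let ?f = "\<lambda>t. poly (map_poly complex_of_real p') (cis t)"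
  show thesis
  proof (rule that)
    fix t
    have "cos t * Im_poly p (cis t) = Im (of_real (cos t) * (cis t * ?f t))"
      by (simp add: pCons Im_poly_def map_poly_pCons)
    also have "of_real (cos t) * cis t = (1 + cis t * cis t) / 2"
      using sin_cos_squared_add[of t] by (simp add: complex_eq_iff power2_eq_square field_simps)
    then have "of_real (cos t) * (cis t * ?f t) = (1 + cis t * cis t) / 2 * ?f t"
      by (metis mult.assoc)
    also have "(1 + cis t * cis t) / 2 * ?f t =
        poly (map_poly of_real (p' + pCons 0 (pCons 0 p'))) (cis t) / 2"
      by (simp add: map_poly_of_real_add map_poly_pCons algebra_simps add_divide_distrib)
    finally show "Im_poly (smult (1 / 2) (p' + pCons 0 (pCons 0 p'))) (cis t) = cos t * Im_poly p (cis t)"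
      by (simp add: Im_poly_smult, simp add: Im_poly_def)
  qed
qed

text \<open>Horner's scheme: each step multiplies by \<open>cos t\<close> and adds
  \<open>a * sin t\<close>, the imaginary part of \<open>a * cis t\<close>.\<close>

lemma Im_poly_sin_poly_cos:
  "\<exists>q. \<forall>t. Im_poly q (cis t) = sin t * poly p (cos t)"
proof (induction p)
  case 0
  show ?case by (rule exI[of _ 0]) (simp add: Im_poly_def)
next
  case (pCons a p)
  then obtain q where q: "\<And>t. Im_poly q (cis t) = sin t * poly p (cos t)" by blast
  obtain q' where "\<And>t. Im_poly q' (cis t) = cos t * Im_poly q (cis t)"
    using Im_poly_cos_mult[of q] by blast
  then show ?case using q
    by (intro exI[of _ "[:0, a:] + q'"])
      (simp add: Im_poly_add, simp add: Im_poly_def map_poly_pCons algebra_simps)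
qed

text \<open>Soft thresholding makes \<open>h\<close> vanish near both end points, so that it can be divided by
  \<open>sin t\<close>; the quotient is then approximated by a polynomial in \<open>cos t\<close>.\<close>

lemma approx_by_Im_poly_cis:
  fixes h :: "real \<Rightarrow> real"
  assumes cont: "continuous_on {0..pi} h" and zero: "h 0 = 0" "h pi = 0" and "e > 0"
  obtains p where "\<And>t. 0 \<le> t \<Longrightarrow> t \<le> pi \<Longrightarrow> \<bar>h t - Im_poly p (cis t)\<bar> \<le> e"
proof -
  define s where "s = (\<lambda>y::real. y - max (- (e / 2)) (min y (e / 2)))"
  have s: "\<bar>s y - y\<bar> \<le> e / 2" "\<bar>y\<bar> \<le> e / 2 \<Longrightarrow> s y = 0" for y
    using \<open>e > 0\<close> by (auto simp: s_def)
  have conts: "continuous_on A s" for A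
    unfolding s_def by (intro continuous_intros)
  define k where "k = (\<lambda>x. h (arccos x))"
  have contk: "continuous_on {-1..1} k"
    unfolding k_def
    by (rule continuous_on_compose2[OF cont continuous_on_arccos'])
      (auto intro: arccos_lbound arccos_ubound)
  have k1: "k 1 = 0" "k (-1) = 0" by (simp_all add: k_def zero)
  \<comment> \<open>At \<open>x = 1\<close> and \<open>x = -1\<close> this is \<open>0 / 0\<close>,
    which evaluates to 0, the value that continuity demands.\<close>
  define q where "q = (\<lambda>x. s (k x) / sqrt (1 - x\<^sup>2))"
  \<comment> \<open>A closed cover of the interval: \<open>q\<close> is 0 on \<open>S\<close>, while
    \<open>T\<close> avoids both end points because \<open>k\<close> vanishes there, so the
    denominator is nonzero on \<open>T\<close>.\<close>
  define S where "S = {x\<in>{-1..1}. k x \<in> {- (e / 2)..e / 2}}"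
  define T where "T = {x\<in>{-1..1}. k x \<in> {..- (e / 2)} \<union> {e / 2..}}"
  have "{-1..1} = S \<union> T" by (auto simp: S_def T_def)
  have "continuous_on (S \<union> T) q"
  proof (rule continuous_on_closed_Un)
    have "closed ({-1..1} \<inter> k -` {- (e / 2)..e / 2})"
      by (intro continuous_closed_preimage contk) auto
    then show "closed S" by (simp add: S_def Int_def vimage_def)
    have "closed ({-1..1} \<inter> k -` ({..- (e / 2)} \<union> {e / 2..}))"
      by (intro continuous_closed_preimage contk closed_Un) auto
    then show "closed T" by (simp add: T_def Int_def vimage_def)
    show "continuous_on S q"
      by (rule continuous_on_eq[of _ "\<lambda>_. 0"]) (auto simp: q_def S_def s)
    have "1 - x\<^sup>2 \<noteq> 0" if "x \<in> T" for x
      using that k1 \<open>e > 0\<close> by (auto simp: T_def power2_eq_1_iff)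
    then show "continuous_on T q"
      unfolding q_def
      by (intro continuous_intros continuous_on_compose2[OF conts[of UNIV]]
          continuous_on_subset[OF contk]) (auto simp: T_def)
  qed
  then have "continuous_on {-1..1} q" using \<open>{-1..1} = S \<union> T\<close> by simp
  then obtain g where g: "real_polynomial_function g"
    "\<And>x. x \<in> {-1..1} \<Longrightarrow> \<bar>q x - g x\<bar> < e / 2"
    using Stone_Weierstrass_real_polynomial_function[of "{-1..1}" q "e / 2"] \<open>e > 0\<close> by auto
  obtain a n where a: "g = (\<lambda>x. \<Sum>i\<le>n. a i * x ^ i)"
    using real_polynomial_function_imp_sum[OF g(1)] by blast
  define P where "P = (\<Sum>i\<le>n. monom (a i) i)"
  have P: "poly P x = g x" for x
    by (simp add: P_def a poly_sum poly_monom)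
  obtain p where p: "\<And>t. Im_poly p (cis t) = sin t * poly P (cos t)"
    using Im_poly_sin_poly_cos[of P] by blast
  show thesis
  proof (rule that)
    fix t assume t: "0 \<le> t" "t \<le> pi"
    have sint: "sqrt (1 - (cos t)\<^sup>2) = sin t"
      using t sin_ge_zero[of t] by (simp add: cos_squared_eq)
    have "k (cos t) = h t" using t by (simp add: k_def arccos_cos)
    have "s (h t) = sin t * q (cos t)"
    proof (cases "sin t = 0")
      case True
      then have "(cos t)\<^sup>2 = 1" using sin_cos_squared_add[of t] by simp
      then have "k (cos t) = 0" using k1 by (auto simp: power2_eq_1_iff)
      then show ?thesis using True s(2)[of 0] \<open>e > 0\<close> \<open>k (cos t) = h t\<close> by simp
    qed (simp add: q_def sint \<open>k (cos t) = h t\<close>)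
    \<comment> \<open>Half of the error comes from the polynomial approximation, damped by
      \<open>\<bar>sin t\<bar> \<le> 1\<close>, and the other half from the thresholding.\<close>
    then have "\<bar>s (h t) - Im_poly p (cis t)\<bar> = \<bar>sin t\<bar> * \<bar>q (cos t) - g (cos t)\<bar>"
      by (simp add: p P abs_mult flip: right_diff_distrib)
    also have "\<dots> \<le> 1 * (e / 2)"
      using g(2)[of "cos t"] by (intro mult_mono) auto
    finally show "\<bar>h t - Im_poly p (cis t)\<bar> \<le> e" using s(1)[of "h t"] by linarith
  qed
qed

lemma continuous_on_half_circle:
  assumes "dirichlet_harmonic v" "r > 0"
  shows "continuous_on {0..pi} (\<lambda>t. v (of_real r * cis t))"
proof (rule continuous_on_compose2[of "{z. 0 \<le> Im z}" v _ "\<lambda>t. of_real r * cis t"])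
  show "continuous_on {z. 0 \<le> Im z} v" using assms by (simp add: dirichlet_harmonic_def)
  show "continuous_on {0..pi} (\<lambda>t. of_real r * cis t)"
    by (intro continuous_intros)
qed (use assms in \<open>auto simp: sin_ge_zero\<close>)

text \<open>The bound is arranged on the half circle only; the maximum principle, applied to the
  difference, carries it to the whole half disc.\<close>

lemma approx_by_Im_poly:
  assumes v: "dirichlet_harmonic v" and "r > 0" "e > 0"
  obtains p where "\<And>z. 0 \<le> Im z \<Longrightarrow> cmod z \<le> r \<Longrightarrow> \<bar>v z - Im_poly p z\<bar> \<le> e"
proof -
  have real: "v (of_real x) = 0" for x using v by (simp add: dirichlet_harmonic_def)
  have "v (of_real r * cis 0) = 0" "v (of_real r * cis pi) = 0"
    using real[of r] real[of "- r"] by simp_all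
  then obtain p where p:
    "\<And>t. 0 \<le> t \<Longrightarrow> t \<le> pi \<Longrightarrow> \<bar>v (of_real r * cis t) - Im_poly p (cis t)\<bar> \<le> e"
    using approx_by_Im_poly_cis[OF continuous_on_half_circle[OF v \<open>r > 0\<close>] _ _ \<open>e > 0\<close>] by blast
  \<comment> \<open>Substituting \<open>z / r\<close> moves the approximant from the unit half
    circle to radius \<open>r\<close> and keeps its coefficients real.\<close>
  define p' where "p' = pcompose p [:0, 1 / r:]"
  have p': "Im_poly p' (of_real r * z) = Im_poly p z" for z
    using \<open>r > 0\<close>
    by (simp add: p'_def Im_poly_def map_poly_of_real_pcompose map_poly_pCons poly_pcompose)
  show thesis
  proof (rule that)
    fix z assume z: "0 \<le> Im z" "cmod z \<le> r"
    show "\<bar>v z - Im_poly p' z\<bar> \<le> e"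
    proof (rule half_disc_abs_bound[OF _ _ _ z])
      show "dirichlet_harmonic (\<lambda>z. v z - Im_poly p' z)"
        by (intro dirichlet_harmonic_diff dirichlet_harmonic_Im_poly v)
      fix w assume w: "0 \<le> Im w" "cmod w = r"
      then obtain t where t: "0 \<le> t" "t \<le> pi" "w = of_real r * cis t"
        using half_circle_polar[of w] by auto
      then show "\<bar>v w - Im_poly p' w\<bar> \<le> e" using p[OF t(1,2)] by (simp add: p')
    qed (use \<open>e > 0\<close> in simp)
  qed
qed

section \<open>Sine coefficients\<close>

text \<open>Left without the normalising factor \<open>2 / pi\<close>, which reappears when a
  polynomial is recovered from its coefficients.\<close>

definition sine_coeff :: "(complex \<Rightarrow> real) \<Rightarrow> nat \<Rightarrow> real \<Rightarrow> real" where
  "sine_coeff v j r = integral {0..pi} (\<lambda>t. v (of_real r * cis t) * sin (real j * t))"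

lemma sine_coeff_integrable:
  assumes "dirichlet_harmonic v" "r > 0"
  shows "(\<lambda>t. v (of_real r * cis t) * sin (real j * t)) integrable_on {0..pi}"
  by (intro integrable_continuous_real continuous_on_mult continuous_on_half_circle[OF assms]
      continuous_on_sin continuous_on_const continuous_on_id)

lemma sine_coeff_diff:
  assumes "dirichlet_harmonic v" "dirichlet_harmonic w" "r > 0"
  shows "sine_coeff (\<lambda>z. v z - w z) j r = sine_coeff v j r - sine_coeff w j r"
  unfolding sine_coeff_def
  using integral_diff[OF sine_coeff_integrable[OF assms(1,3), of j] sine_coeff_integrable[OF assms(2,3), of j]]
  by (simp add: left_diff_distrib)

lemma sine_coeff_bound:
  assumes v: "dirichlet_harmonic v" "r > 0"
    and bound: "\<And>z. 0 \<le> Im z \<Longrightarrow> cmod z = r \<Longrightarrow> \<bar>v z\<bar> \<le> e"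
  shows "\<bar>sine_coeff v j r\<bar> \<le> pi * e"
proof -
  have "norm (sine_coeff v j r) \<le> e * (pi - 0)"
    unfolding sine_coeff_def
  proof (rule integral_bound)
    show "continuous_on {0..pi} (\<lambda>t. v (of_real r * cis t) * sin (real j * t))"
      by (intro continuous_on_mult continuous_on_half_circle[OF v]
          continuous_on_sin continuous_on_const continuous_on_id)
    fix t assume t: "t \<in> {0..pi}"
    have "\<bar>v (of_real r * cis t)\<bar> * \<bar>sin (real j * t)\<bar> \<le> e * 1"
      using t v(2) bound[of "of_real r * cis t"]
      by (intro mult_mono) (auto simp: norm_mult sin_ge_zero intro: order_trans[OF abs_ge_zero])
    then show "norm (v (of_real r * cis t) * sin (real j * t)) \<le> e"
      by (simp add: abs_mult)
  qed auto
  then show ?thesis by (simp add: mult.commute)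
qed

text \<open>The test polynomial \<open>q\<close> is evaluated on the unit circle whatever
  \<open>r\<close> is, so the dependence on \<open>r\<close> sits entirely in the sine coefficients
  of \<open>v\<close>.\<close>

lemma integral_mult_Im_poly_cis:
  assumes "dirichlet_harmonic v" "r > 0"
  shows "integral {0..pi} (\<lambda>t. v (of_real r * cis t) * Im_poly q (cis t))
    = (\<Sum>j\<le>degree q. coeff q j * sine_coeff v j r)"
proof -
  have "(\<lambda>t. v (of_real r * cis t) * Im_poly q (cis t))
      = (\<lambda>t. \<Sum>j\<le>degree q. coeff q j * (v (of_real r * cis t) * sin (real j * t)))"
    using Im_poly_polar[of q 1] by (simp add: sum_distrib_left mult_ac)
  then show ?thesis
    using sine_coeff_integrable[OF assms]
    by (simp add: integral_sum sine_coeff_def integrable_on_mult_right)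
qed

lemma sine_coeff_Im_poly:
  assumes "j > 0"
  shows "sine_coeff (Im_poly p) j r = pi / 2 * coeff p j * r ^ j"
proof -
  have int: "(\<lambda>t. sin (real j * t) * sin (real k * t)) integrable_on {0..pi}" for k
    by (intro integrable_continuous_real continuous_intros)
  have "(\<lambda>t. Im_poly p (of_real r * cis t) * sin (real j * t))
      = (\<lambda>t. \<Sum>k\<le>degree p. coeff p k * r ^ k * (sin (real j * t) * sin (real k * t)))"
    unfolding Im_poly_polar sum_distrib_right by (simp add: mult_ac)
  then have "sine_coeff (Im_poly p) j r
      = (\<Sum>k\<le>degree p. coeff p k * r ^ k * (if j = k then pi / 2 else 0))"
    using int by (simp add: sine_coeff_def integral_sum integrable_on_mult_right
        sin_mult_integral[OF assms])
  also have "\<dots> = (\<Sum>k\<le>degree p. if j = k then coeff p k * r ^ k * (pi / 2) else 0)"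
    by (intro sum.cong) auto
  also have "\<dots> = pi / 2 * coeff p j * r ^ j"
    by (auto simp: coeff_eq_0)
  finally show ?thesis .
qed

text \<open>Exact for polynomials, and preserved in the limit. Since \<open>s \<le> r\<close>, a
  single approximant on the half disc of radius \<open>r\<close> serves both radii.\<close>

lemma sine_coeff_homogeneous_le:
  assumes v: "dirichlet_harmonic v" and "j > 0" and s: "0 < s" "s \<le> r"
  shows "sine_coeff v j s * r ^ j = sine_coeff v j r * s ^ j"
proof -
  let ?D = "sine_coeff v j s * r ^ j - sine_coeff v j r * s ^ j"
  \<comment> \<open>With accuracy \<open>e / M\<close>, the errors at the two radii, weighted by
    \<open>r ^ j\<close> and \<open>s ^ j\<close>, add up to \<open>e\<close>.\<close>
  define M where "M = pi * (r ^ j + s ^ j)"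
  have "M > 0" using s by (auto simp: M_def intro!: mult_pos_pos add_pos_pos)
  have "\<bar>?D\<bar> \<le> 0 + e" if e: "e > 0" for e
  proof -
    obtain p where p: "\<And>z. 0 \<le> Im z \<Longrightarrow> cmod z \<le> r \<Longrightarrow> \<bar>v z - Im_poly p z\<bar> \<le> e / M"
      using approx_by_Im_poly[OF v, of r "e / M"] s e \<open>M > 0\<close> by (meson divide_pos_pos less_le_trans)
    have d: "dirichlet_harmonic (\<lambda>z. v z - Im_poly p z)"
      by (intro dirichlet_harmonic_diff dirichlet_harmonic_Im_poly v)
    have b: "\<bar>sine_coeff v j x - pi / 2 * coeff p j * x ^ j\<bar> \<le> pi * (e / M)"
      if "0 < x" "x \<le> r" for x
      using sine_coeff_bound[OF d that(1), of "e / M" j] p that \<open>j > 0\<close>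
      by (simp add: sine_coeff_diff[OF v dirichlet_harmonic_Im_poly] sine_coeff_Im_poly)
    have "?D = (sine_coeff v j s - pi / 2 * coeff p j * s ^ j) * r ^ j
        - (sine_coeff v j r - pi / 2 * coeff p j * r ^ j) * s ^ j"
      by (simp add: algebra_simps)
    also have "\<bar>\<dots>\<bar> \<le> \<bar>sine_coeff v j s - pi / 2 * coeff p j * s ^ j\<bar> * r ^ j
        + \<bar>sine_coeff v j r - pi / 2 * coeff p j * r ^ j\<bar> * s ^ j"
      using s by (intro order_trans[OF abs_triangle_ineq4]) (simp add: abs_mult)
    also have "\<dots> \<le> pi * (e / M) * r ^ j + pi * (e / M) * s ^ j"
      using s by (intro add_mono mult_right_mono b) auto
    also have "\<dots> = e / M * M"
      unfolding M_def distrib_left distrib_right by (simp only: mult_ac)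
    also have "\<dots> = e" using \<open>M > 0\<close> by simp
    finally show ?thesis by simp
  qed
  then have "\<bar>?D\<bar> \<le> 0" by (rule field_le_epsilon)
  then show ?thesis by simp
qed

lemma sine_coeff_homogeneous:
  assumes "dirichlet_harmonic v" "j > 0" "r > 0"
  shows "sine_coeff v j r = sine_coeff v j 1 * r ^ j"
  using sine_coeff_homogeneous_le[OF assms(1,2), of 1 r]
    sine_coeff_homogeneous_le[OF assms(1,2), of r 1] assms(3)
  by (cases "r \<le> 1") auto

section \<open>Completeness of the sines and the cut-off by growth\<close>

text \<open>\<open>w\<close> is orthogonal to every sine polynomial, and sine polynomials
  approximate \<open>w\<close> uniformly, so the integral of its square is 0.\<close>

lemma vanish_on_half_circle:
  assumes w: "dirichlet_harmonic w" and r: "r > 0"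
    and zero: "\<And>j. j > 0 \<Longrightarrow> sine_coeff w j r = 0" and t: "0 \<le> t" "t \<le> pi"
  shows "w (of_real r * cis t) = 0"
proof -
  let ?g = "\<lambda>t. w (of_real r * cis t)"
  have g: "continuous_on {0..pi} ?g" by (rule continuous_on_half_circle[OF w r])
  have "compact (?g ` {0..pi})" by (intro compact_continuous_image g) auto
  then obtain M where M: "M > 0" "\<And>t. t \<in> {0..pi} \<Longrightarrow> \<bar>?g t\<bar> \<le> M"
    using compact_imp_bounded bounded_pos[of "?g ` {0..pi}"] by auto
  have ends: "?g 0 = 0" "?g pi = 0"
  proof -
    have "w (of_real x) = 0" for x using w by (simp add: dirichlet_harmonic_def)
    from this[of r] this[of "- r"] show "?g 0 = 0" "?g pi = 0" by simp_all
  qed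
  have "integral {0..pi} (\<lambda>t. ?g t * ?g t) \<le> 0 + e" if e: "e > 0" for e
  proof -
    \<comment> \<open>The accuracy absorbs the bound \<open>M\<close> of \<open>w\<close> and the
      length \<open>pi\<close> of the interval.\<close>
    obtain q where q: "\<And>t. 0 \<le> t \<Longrightarrow> t \<le> pi \<Longrightarrow> \<bar>?g t - Im_poly q (cis t)\<bar> \<le> e / (M * pi)"
      using approx_by_Im_poly_cis[OF g ends, of "e / (M * pi)"] M(1) e by (meson divide_pos_pos mult_pos_pos pi_gt_zero)
    have contq: "continuous_on {0..pi} (\<lambda>t. Im_poly q (cis t))"
      using continuous_on_half_circle[OF dirichlet_harmonic_Im_poly, of 1 q] by simp
    have "coeff q j * sine_coeff w j r = 0" for j
      using zero[of j] by (cases "j = 0") (auto simp: sine_coeff_def)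
    then have "integral {0..pi} (\<lambda>t. ?g t * Im_poly q (cis t)) = 0"
      unfolding integral_mult_Im_poly_cis[OF w r] by (intro sum.neutral) blast
    then have "integral {0..pi} (\<lambda>t. ?g t * ?g t)
        = integral {0..pi} (\<lambda>t. ?g t * ?g t) - integral {0..pi} (\<lambda>t. ?g t * Im_poly q (cis t))"
      by simp
    also have "\<dots> = integral {0..pi} (\<lambda>t. ?g t * ?g t - ?g t * Im_poly q (cis t))"
      by (intro integral_diff[symmetric] integrable_continuous_real continuous_on_mult g contq)
    also have "\<dots> \<le> norm \<dots>" by simp
    also have "\<dots> \<le> e / pi * (pi - 0)"
    proof (rule integral_bound)
      show "continuous_on {0..pi} (\<lambda>t. ?g t * ?g t - ?g t * Im_poly q (cis t))"
        by (intro continuous_on_diff continuous_on_mult g contq)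
      fix t assume t: "t \<in> {0..pi}"
      have "\<bar>?g t\<bar> * \<bar>?g t - Im_poly q (cis t)\<bar> \<le> M * (e / (M * pi))"
        using q t M by (intro mult_mono) auto
      then show "norm (?g t * ?g t - ?g t * Im_poly q (cis t)) \<le> e / pi"
        using M(1) by (simp flip: right_diff_distrib abs_mult)
    qed auto
    finally show ?thesis by simp
  qed
  then have "integral {0..pi} (\<lambda>t. ?g t * ?g t) \<le> 0" by (rule field_le_epsilon)
  moreover have "integral {0..pi} (\<lambda>t. ?g t * ?g t) \<ge> 0"
    by (intro integral_nonneg integrable_continuous_real continuous_on_mult g) auto
  ultimately have "integral {0..pi} (\<lambda>t. ?g t * ?g t) = 0" by simp
  moreover have "continuous_on {0..pi} (\<lambda>t. ?g t * ?g t)"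
    by (intro continuous_on_mult g)
  ultimately have "\<forall>t\<in>{0..pi}. ?g t * ?g t = 0"
    using integral_eq_0_iff[of 0 pi "\<lambda>t. ?g t * ?g t"] by simp
  then show ?thesis using t by simp
qed

text \<open>The weight \<open>sin\<^sup>2\<^sup>K t\<close> compensates the blow-up of the growth bound near the real axis,
  and since \<open>w - 1 / w = 2 \<i> sin t\<close> for \<open>w = cis t\<close>, it is the polynomial
  \<open>(- (w\<^sup>2 - 1)\<^sup>2 / 4) ^ K\<close> up to a factor \<open>w\<^sup>2\<^sup>K\<close>.\<close>

lemma Im_poly_sin_power:
  obtains q where "degree q = n + 4 * K" "\<And>t. Im_poly q (cis t) = sin t ^ (2 * K) * sin (real (n + 2 * K) * t)"
proof
  define b where "b = smult (- 1 / 4) ([:- 1, 0, 1 :: real:] ^ 2)"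
  let ?q = "monom 1 n * b ^ K"
  have b: "b \<noteq> 0" "degree b = 4" by (simp_all add: b_def degree_power_eq)
  then show "degree ?q = n + 4 * K"
    by (simp add: degree_mult_eq degree_power_eq degree_monom_eq monom_eq_0_iff mult.commute)
  fix t
  have "poly (map_poly complex_of_real b) (cis t) = - ((cis t * cis t - 1)\<^sup>2 / 4)"
    by (simp add: b_def map_poly_smult map_poly_of_real_power map_poly_pCons del: smult_minus_left)
  also have "cis t * cis t - 1 = cis t * (2 * \<i> * of_real (sin t))"
    using sin_cos_squared_add[of t] by (simp add: complex_eq_iff power2_eq_square)
  also have "- ((cis t * (2 * \<i> * of_real (sin t)))\<^sup>2 / 4) = (cis t)\<^sup>2 * of_real ((sin t)\<^sup>2)"
    by (simp add: power_mult_distrib)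
  finally have "poly (map_poly complex_of_real ?q) (cis t)
      = cis t ^ n * ((cis t)\<^sup>2 * of_real ((sin t)\<^sup>2)) ^ K"
    by (simp add: map_poly_of_real_mult map_poly_of_real_power map_poly_monom poly_monom)
  also have "\<dots> = cis t ^ (n + 2 * K) * of_real (sin t ^ (2 * K))"
    by (simp add: power_mult_distrib power_add flip: power_mult)
  also have "\<dots> = cis (real (n + 2 * K) * t) * of_real (sin t ^ (2 * K))"
    by (simp only: Complex.DeMoivre)
  finally show "Im_poly ?q (cis t) = sin t ^ (2 * K) * sin (real (n + 2 * K) * t)"
    by (simp add: Im_poly_def mult.commute)
qed

text \<open>By homogeneity the integral of \<open>v\<close> against the weighted sine is a real
  polynomial in \<open>r\<close>. Growth bounds it by a multiple of \<open>r ^ K\<close>, so its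
  coefficient at degree \<open>j > K\<close> vanishes.\<close>

lemma sine_coeff_eq_0_of_growth:
  assumes v: "dirichlet_harmonic v" and "K > 0" "R > 0"
    and growth: "\<And>r t. r > R \<Longrightarrow> 0 \<le> t \<Longrightarrow> t \<le> pi \<Longrightarrow>
      \<bar>v (of_real r * cis t)\<bar> * sin t ^ (2 * K) \<le> C * r ^ K"
    and j: "j \<ge> 4 * K"
  shows "sine_coeff v j 1 = 0"
proof -
  \<comment> \<open>Chosen to give the test polynomial degree exactly \<open>j\<close>: its nonzero
    leading coefficient then multiplies \<open>sine_coeff v j 1\<close>.\<close>
  define n where "n = j - 4 * K"
  obtain q where q: "degree q = n + 4 * K"
    "\<And>t. Im_poly q (cis t) = sin t ^ (2 * K) * sin (real (n + 2 * K) * t)"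
    using Im_poly_sin_power[of n K] by blast
  have deg: "degree q = j" using q j by (simp add: n_def)
  define P where "P = (\<Sum>i\<le>degree q. monom (coeff q i * sine_coeff v i 1) i)"
  have coeffP: "coeff P i = (if i \<le> degree q then coeff q i * sine_coeff v i 1 else 0)" for i
    by (simp add: P_def coeff_sum coeff_monom)
  have "\<bar>poly P r\<bar> \<le> (C * pi) * r ^ K" if "r > R" for r
  proof -
    have r: "r > 0" using that \<open>R > 0\<close> by simp
    have "coeff q i * sine_coeff v i 1 * r ^ i = coeff q i * sine_coeff v i r" for i
    proof (cases "i = 0")
      case False
      then show ?thesis using sine_coeff_homogeneous[OF v _ r, of i] by simp
    qed (simp add: sine_coeff_def)
    then have "poly P r = integral {0..pi} (\<lambda>t. v (of_real r * cis t) * Im_poly q (cis t))"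
      by (simp only: integral_mult_Im_poly_cis[OF v r] P_def poly_sum poly_monom)
    also have "norm \<dots> \<le> C * r ^ K * (pi - 0)"
    proof (rule integral_bound)
      show "continuous_on {0..pi} (\<lambda>t. v (of_real r * cis t) * Im_poly q (cis t))"
        using continuous_on_half_circle[OF dirichlet_harmonic_Im_poly, of 1 q]
        by (intro continuous_on_mult continuous_on_half_circle[OF v r]) simp
      fix t assume t: "t \<in> {0..pi}"
      have "\<bar>v (of_real r * cis t) * Im_poly q (cis t)\<bar>
          = \<bar>v (of_real r * cis t)\<bar> * sin t ^ (2 * K) * \<bar>sin (real (n + 2 * K) * t)\<bar>"
        by (simp add: q abs_mult power_abs power_mult)
      also have "\<dots> \<le> \<bar>v (of_real r * cis t)\<bar> * sin t ^ (2 * K) * 1"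
        by (intro mult_left_mono) (auto simp: power_mult)
      also have "\<dots> \<le> C * r ^ K" using growth[OF that] t by simp
      finally show "norm (v (of_real r * cis t) * Im_poly q (cis t)) \<le> C * r ^ K" by simp
    qed auto
    finally show ?thesis by (simp add: mult_ac)
  qed
  then have "coeff P j = 0"
    by (rule coeff_eq_0_of_poly_bound[of R]) (use j \<open>K > 0\<close> in auto)
  then have "coeff q j = 0 \<or> sine_coeff v j 1 = 0" unfolding coeffP deg by simp
  moreover have "coeff q j \<noteq> 0"
  proof -
    have "degree q \<noteq> 0" using deg j \<open>K > 0\<close> by simp
    then have "lead_coeff q \<noteq> 0" by auto
    then show ?thesis by (simp add: deg)
  qed
  ultimately show ?thesis by blast
qed

text \<open>Only finitely many sine coefficients survive. A polynomial with the same ones differs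
  from \<open>v\<close> by a function that vanishes on every half circle.\<close>

lemma dirichlet_harmonic_eq_Im_poly:
  assumes v: "dirichlet_harmonic v" and "K > 0" "R > 0"
    and growth: "\<And>r t. r > R \<Longrightarrow> 0 \<le> t \<Longrightarrow> t \<le> pi \<Longrightarrow>
      \<bar>v (of_real r * cis t)\<bar> * sin t ^ (2 * K) \<le> C * r ^ K"
  obtains p where "\<And>z. 0 < Im z \<Longrightarrow> v z = Im_poly p z"
proof -
  define p where "p = (\<Sum>i<4 * K. monom (2 / pi * sine_coeff v i 1) i)"
  \<comment> \<open>Stopping at \<open>4 * K\<close> loses nothing, as the coefficients from there
    on are 0.\<close>
  have coeff: "coeff p j = 2 / pi * sine_coeff v j 1" for j
    using sine_coeff_eq_0_of_growth[OF assms, of j]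
    by (auto simp: p_def coeff_sum coeff_monom)
  let ?w = "\<lambda>z. v z - Im_poly p z"
  have w: "dirichlet_harmonic ?w"
    by (intro dirichlet_harmonic_diff dirichlet_harmonic_Im_poly v)
  have zero: "sine_coeff ?w j r = 0" if "j > 0" "r > 0" for j r
    using that sine_coeff_homogeneous[OF v that]
    by (simp add: sine_coeff_diff[OF v dirichlet_harmonic_Im_poly] sine_coeff_Im_poly coeff)
  show thesis
  proof (rule that)
    fix z assume z: "0 < Im z"
    then obtain t where t: "0 \<le> t" "t \<le> pi" "z = of_real (cmod z) * cis t"
      using half_circle_polar[of z] by auto
    have "cmod z > 0" using z by auto
    from vanish_on_half_circle[OF w this zero[OF _ this] t(1,2)] show "v z = Im_poly p z"
      using t(3) by simp
  qed
qed

text \<open>On the ray the function is a real polynomial in \<open>t\<close> with coefficients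
  \<open>coeff p j * sin (real j * \<theta>)\<close>. Growth slower than \<open>t\<close> kills all
  of positive degree, and irrationality keeps the sines nonzero.\<close>

lemma Im_poly_eq_0_of_ray:
  assumes angle: "\<not> (\<exists>q\<in>\<rat>. \<theta> = q * pi)"
    and ray: "((\<lambda>t. Im_poly p (of_real t * cis \<theta>) / t) \<longlongrightarrow> 0) at_top"
  shows "Im_poly p z = 0"
proof -
  define P where "P = (\<Sum>j\<le>degree p. monom (coeff p j * sin (real j * \<theta>)) j)"
  have coeffP: "coeff P j = coeff p j * sin (real j * \<theta>)" for j
    by (auto simp: P_def coeff_sum coeff_monom coeff_eq_0)
  have poly: "poly P t = Im_poly p (of_real t * cis \<theta>)" for t
    unfolding P_def poly_sum poly_monom Im_poly_polar by (simp add: mult_ac)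
  have "degree P = 0"
  proof (rule ccontr)
    assume d: "degree P \<noteq> 0"
    have "((\<lambda>t. poly P t / t ^ degree P) \<longlongrightarrow> 0) at_top"
    proof (rule Lim_null_comparison)
      show "((\<lambda>t. \<bar>Im_poly p (of_real t * cis \<theta>) / t\<bar>) \<longlongrightarrow> 0) at_top"
        using tendsto_rabs_zero[OF ray] .
      show "\<forall>\<^sub>F t in at_top. norm (poly P t / t ^ degree P) \<le> \<bar>Im_poly p (of_real t * cis \<theta>) / t\<bar>"
        using eventually_ge_at_top[of 1]
      proof eventually_elim
        case (elim t)
        \<comment> \<open>For \<open>t \<ge> 1\<close> and positive degree, dividing by the top
          power gives something no larger than dividing by \<open>t\<close>.\<close>
        then have "t ^ 1 \<le> t ^ degree P" using d by (intro power_increasing) auto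
        then show ?case using elim by (simp add: poly abs_div frac_le)
      qed
    qed
    then have "lead_coeff P = 0"
      using poly_div_power_tendsto_lead_coeff[of P] tendsto_unique trivial_limit_at_top_linorder
      by blast
    then show False using d by simp
  qed
  have "coeff p j = 0" if "j > 0" for j
  proof -
    have "coeff P j = 0" using \<open>degree P = 0\<close> that by (simp add: coeff_eq_0)
    moreover have "sin (real j * \<theta>) \<noteq> 0"
    proof
      assume "sin (real j * \<theta>) = 0"
      then obtain i :: int where "real j * \<theta> = of_int i * pi"
        using sin_zero_iff_int2 by blast
      then have "\<theta> = (of_int i / of_nat j) * pi" using that by (simp add: field_simps)
      moreover have "(of_int i / of_nat j :: real) \<in> \<rat>" by simp
      ultimately show False using angle by blast
    qed
    ultimately show ?thesis by (simp add: coeffP)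
  qed
  \<comment> \<open>What remains is a real constant, whose imaginary part is 0.\<close>
  then have "p = [:coeff p 0:]"
    by (intro poly_eqI) (auto simp: coeff_pCons split: nat.split)
  then have "Im_poly p z = Im_poly [:coeff p 0:] z" by simp
  then show ?thesis by (simp add: Im_poly_def map_poly_pCons)
qed

section \<open>Harmonic functions on the upper half-plane\<close>

lemma partial_deriv_along_line:
  assumes "f differentiable (at (z + of_real t * c))"
  shows "((\<lambda>t. f (z + of_real t * c)) has_vector_derivative partial_deriv c f (z + of_real t * c)) (at t)"
proof -
  let ?D = "frechet_derivative f (at (z + of_real t * c))"
  have D: "(f has_derivative ?D) (at (z + of_real t * c))"
    using assms frechet_derivative_works by blast
  have "((\<lambda>t. z + of_real t * c) has_derivative (\<lambda>h. h *\<^sub>R c)) (at t)"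
    by (auto intro!: derivative_eq_intros simp: scaleR_conv_of_real)
  from diff_chain_at[OF this D]
  have "((\<lambda>t. f (z + of_real t * c)) has_derivative (\<lambda>h. ?D (h *\<^sub>R c))) (at t)"
    by (simp add: o_def)
  moreover have "?D (h *\<^sub>R c) = h *\<^sub>R ?D c" for h
    using has_derivative_bounded_linear[OF D] by (simp add: linear_simps)
  ultimately show ?thesis
    by (simp add: has_vector_derivative_def partial_deriv_def)
qed

text \<open>A real-linear \<open>L\<close> commutes with real differentiation; it stands for
  \<open>Re\<close> and \<open>Im\<close>. The function \<open>v\<close> is tied to \<open>u\<close>
  in the open half-plane only, to allow the extension by 0.\<close>

lemma line_laplace_of_harmonic:
  assumes L: "bounded_linear L" and "harmonic_on upper_half_plane u" "0 < Im z"
    and v: "\<And>w. 0 < Im w \<Longrightarrow> v w = L (u w)"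
  shows "line_laplace v z"
proof -
  let ?H = upper_half_plane
  have diff: "u differentiable (at w)" "partial_deriv 1 u differentiable (at w)"
    "partial_deriv \<i> u differentiable (at w)" and lap: "laplacian u w = 0" if "w \<in> ?H" for w
    using assms(2) that unfolding harmonic_on_def C2_on_def C1_on_def by auto
  have along: "((\<lambda>t. L (f (z + of_real t * c))) has_real_derivative
      L (partial_deriv c f (z + of_real t * c))) (at t)"
    if "f differentiable (at (z + of_real t * c))" for f c t
    using bounded_linear.has_vector_derivative[OF L partial_deriv_along_line[OF that]]
    by (simp add: has_real_derivative_iff_has_vector_derivative)
  have first: "((\<lambda>t. v (z + of_real t * c)) has_real_derivative
      L (partial_deriv c u (z + of_real t * c))) (at t)"
    if c: "c = 1 \<or> c = \<i>" and t: "\<bar>t\<bar> < Im z" for c t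
  proof (rule has_field_derivative_transform_within_open[OF along])
    have H: "z + of_real s * c \<in> ?H" if "s \<in> {- Im z<..<Im z}" for s
      using c that by (auto simp: upper_half_plane_def)
    show "u differentiable (at (z + of_real t * c))" using H[of t] t by (intro diff H) auto
    show "L (u (z + of_real s * c)) = v (z + of_real s * c)" if "s \<in> {- Im z<..<Im z}" for s
      using v H[OF that] by (simp add: upper_half_plane_def)
  qed (use t in auto)
  have z: "z \<in> ?H" using \<open>0 < Im z\<close> by (simp add: upper_half_plane_def)
  have "L (partial_deriv 1 (partial_deriv 1 u) z) + L (partial_deriv \<i> (partial_deriv \<i> u) z) = 0"
    using lap[OF z] L by (simp add: laplacian_def linear_simps flip: linear_simps(1)[OF L])
  then show ?thesis
    unfolding line_laplace_def
    using first[of 1] first[of \<i>] along[of "partial_deriv 1 u" 0 1] along[of "partial_deriv \<i> u" 0 \<i>]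
      diff[OF z]
    by (intro exI[of _ "\<lambda>t. L (partial_deriv 1 u (z + of_real t * 1))"]
        exI[of _ "\<lambda>t. L (partial_deriv \<i> u (z + of_real t * \<i>))"]
        exI[of _ "L (partial_deriv 1 (partial_deriv 1 u) z)"]
        exI[of _ "L (partial_deriv \<i> (partial_deriv \<i> u) z)"]) (auto simp: mult.commute[of \<i>])
qed

text \<open>The boundary condition enters through continuity at the real axis: the limit is 0 from
  the open half-plane and along the axis itself, and these two sets make up the closed
  half-plane.\<close>

lemma dirichlet_harmonic_extension:
  assumes L: "bounded_linear L" and u: "harmonic_on upper_half_plane u"
    and boundary: "\<And>x::real. (u \<longlongrightarrow> 0) (at (complex_of_real x) within upper_half_plane)"
  shows "dirichlet_harmonic (\<lambda>z. if 0 < Im z then L (u z) else 0)"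
proof -
  let ?v = "\<lambda>z. if 0 < Im z then L (u z) else 0"
  have "(?v \<longlongrightarrow> ?v z) (at z within {z. 0 \<le> Im z})" if z: "0 \<le> Im z" for z
  proof (cases "Im z = 0")
    case False
    then have "z \<in> upper_half_plane" using z by (simp add: upper_half_plane_def)
    then have "u differentiable (at z)"
      using u by (simp add: harmonic_on_def C2_on_def C1_on_def)
    then have "(u \<longlongrightarrow> u z) (at z)"
      using differentiable_imp_continuous_within isCont_def by blast
    then have lim: "((\<lambda>w. L (u w)) \<longlongrightarrow> L (u z)) (at z)"
      by (rule bounded_linear.tendsto[OF L])
    have "open upper_half_plane"
      unfolding upper_half_plane_def by (rule open_halfspace_Im_gt)
    have "(?v \<longlongrightarrow> L (u z)) (at z)"
      by (rule Lim_transform_within_open[OF lim \<open>open upper_half_plane\<close> \<open>z \<in> upper_half_plane\<close>])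
        (simp add: upper_half_plane_def)
    then show ?thesis
      using False z by (simp add: Lim_at_imp_Lim_at_within)
  next
    case True
    then have "z = of_real (Re z)" by (simp add: complex_eq_iff)
    then have lim: "((\<lambda>w. L (u w)) \<longlongrightarrow> 0) (at z within upper_half_plane)"
      using bounded_linear.tendsto[OF L boundary[of "Re z"]] L by (simp add: linear_simps)
    have "(?v \<longlongrightarrow> 0) (at z within upper_half_plane)"
      by (rule Lim_transform_eventually[OF lim])
        (auto simp: eventually_at_filter upper_half_plane_def)
    moreover have "(?v \<longlongrightarrow> 0) (at z within {z. Im z = 0})"
      by (rule Lim_transform_eventually[OF tendsto_const]) (auto simp: eventually_at_filter)
    ultimately have "(?v \<longlongrightarrow> 0) (at z within upper_half_plane \<union> {z. Im z = 0})"
      by (simp add: Lim_within_Un)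
    moreover have "upper_half_plane \<union> {z. Im z = 0} = {z. 0 \<le> Im z}"
      by (auto simp: upper_half_plane_def)
    ultimately show ?thesis using True by simp
  qed
  moreover have "line_laplace ?v z" if "0 < Im z" for z
    by (rule line_laplace_of_harmonic[OF L u that]) simp
  ultimately show ?thesis
    by (auto simp: dirichlet_harmonic_def continuous_on_def)
qed

section \<open>From the growth and decay conditions to the conclusion\<close>

text \<open>On the circle of radius \<open>r\<close> the base of the growth bound is
  \<open>r / sin t\<close>. The weight cancels the denominator and leaves a factor
  \<open>sin t ^ K \<le> 1\<close>.\<close>

lemma temperate_growth_on_circles:
  assumes temp: "temperate_at_infinity u" and v: "\<And>z. \<bar>v z\<bar> \<le> (if 0 < Im z then cmod (u z) else 0)"
  obtains K :: nat and R C :: real where "K > 0" "R > 0"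
    "\<And>r t. r > R \<Longrightarrow> 0 \<le> t \<Longrightarrow> t \<le> pi \<Longrightarrow> \<bar>v (of_real r * cis t)\<bar> * sin t ^ (2 * K) \<le> C * r ^ K"
proof -
  obtain C R N :: real where "C > 0" "R > 0" "N > 0" and growth:
    "\<And>z. z \<in> upper_half_plane \<Longrightarrow> cmod z > R \<Longrightarrow> cmod (u z) \<le> C * ((cmod z)\<^sup>2 / Im z) powr N"
    using temp unfolding temperate_at_infinity_def by blast
  define K where "K = nat \<lceil>N\<rceil>"
  have K: "K > 0" "N \<le> real K" using \<open>N > 0\<close> by (auto simp: K_def)
  show thesis
  proof (rule that[OF K(1)])
    show "max R 1 > 0" by simp
    fix r t :: real
    assume r: "r > max R 1" and t: "0 \<le> t" "t \<le> pi"
    let ?z = "of_real r * cis t"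
    show "\<bar>v ?z\<bar> * sin t ^ (2 * K) \<le> C * r ^ K"
    proof (cases "sin t > 0")
      case True
      have "\<bar>v ?z\<bar> \<le> cmod (u ?z)" using v[of ?z] r True by simp
      also have "\<dots> \<le> C * ((cmod ?z)\<^sup>2 / Im ?z) powr N"
        using r True by (intro growth) (auto simp: upper_half_plane_def norm_mult)
      also have "(cmod ?z)\<^sup>2 / Im ?z = r / sin t"
        using r by (simp add: norm_mult power2_eq_square)
      \<comment> \<open>The radius exceeds 1, so the base is at least 1 and the exponent may be
        rounded up to the natural number \<open>K\<close>.\<close>
      also have "(r / sin t) powr N \<le> (r / sin t) powr real K"
        using r True order_trans[OF sin_le_one[of t], of r]
        by (intro powr_mono K) (auto simp: field_simps)
      also have "\<dots> = (r / sin t) ^ K"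
        using r True by (intro powr_realpow) auto
      finally have "\<bar>v ?z\<bar> \<le> C * (r / sin t) ^ K" using \<open>C > 0\<close> by simp
      then have "\<bar>v ?z\<bar> * sin t ^ (2 * K) \<le> C * (r / sin t) ^ K * sin t ^ (2 * K)"
        using True by (intro mult_right_mono) auto
      also have "\<dots> = C * r ^ K * sin t ^ K"
        using True by (simp add: power_divide mult_2 power_add)
      also have "\<dots> \<le> C * r ^ K * 1"
        using True r \<open>C > 0\<close> by (intro mult_left_mono power_le_one) auto
      finally show ?thesis by simp
    next
      case False
      then have "sin t = 0" using sin_ge_zero[OF t] by simp
      then show ?thesis using K r \<open>C > 0\<close> by (simp add: zero_power)
    qed
  qed
qed

text \<open>The whole argument for one real component of \<open>u\<close>; the bound on
  \<open>L\<close> transfers the growth condition to it.\<close>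

lemma real_linear_image_vanishes:
  assumes L: "bounded_linear L" "\<And>w. \<bar>L w :: real\<bar> \<le> cmod w"
    and u: "harmonic_on upper_half_plane u" "temperate_at_infinity u"
    and boundary: "\<And>x::real. (u \<longlongrightarrow> 0) (at (complex_of_real x) within upper_half_plane)"
    and angle: "0 < \<theta>" "\<theta> < pi" "\<not> (\<exists>q\<in>\<rat>. \<theta> = q * pi)"
    and ray: "((\<lambda>t::real. u (of_real t * cis \<theta>) / of_real t) \<longlongrightarrow> 0) at_top"
    and z: "0 < Im z"
  shows "L (u z) = 0"
proof -
  let ?v = "\<lambda>z. if 0 < Im z then L (u z) else 0"
  have v: "dirichlet_harmonic ?v"
    by (rule dirichlet_harmonic_extension[OF L(1) u(1) boundary])
  have "\<bar>?v z\<bar> \<le> (if 0 < Im z then cmod (u z) else 0)" for z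
    using L(2) by simp
  from temperate_growth_on_circles[OF u(2) this]
  obtain K :: nat and R C :: real where "K > 0" "R > 0"
    "\<And>r t. r > R \<Longrightarrow> 0 \<le> t \<Longrightarrow> t \<le> pi \<Longrightarrow> \<bar>?v (of_real r * cis t)\<bar> * sin t ^ (2 * K) \<le> C * r ^ K"
    by blast
  from dirichlet_harmonic_eq_Im_poly[OF v this]
  obtain p where p: "\<And>z. 0 < Im z \<Longrightarrow> ?v z = Im_poly p z" by blast
  have "Im_poly p z = 0"
  proof (rule Im_poly_eq_0_of_ray[OF angle(3)])
    have "((\<lambda>t. L (u (of_real t * cis \<theta>) / of_real t)) \<longlongrightarrow> 0) at_top"
      using bounded_linear.tendsto[OF L(1) ray] L(1) by (simp add: linear_simps)
    then show "((\<lambda>t. Im_poly p (of_real t * cis \<theta>) / t) \<longlongrightarrow> 0) at_top"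
    proof (rule Lim_transform_eventually)
      show "\<forall>\<^sub>F t in at_top. L (u (of_real t * cis \<theta>) / of_real t) = Im_poly p (of_real t * cis \<theta>) / t"
        using eventually_gt_at_top[of 0]
      proof eventually_elim
        case (elim t)
        \<comment> \<open>Complex division by \<open>t\<close> is rewritten as real scaling, which
          \<open>L\<close> respects.\<close>
        have "L (u (of_real t * cis \<theta>) / of_real t) = L ((1 / t) *\<^sub>R u (of_real t * cis \<theta>))"
          by (simp add: scaleR_conv_of_real)
        also have "\<dots> = L (u (of_real t * cis \<theta>)) / t"
          using L(1) by (simp add: linear_simps)
        finally show ?case
          using p[of "of_real t * cis \<theta>"] elim sin_gt_zero[OF angle(1,2)] by simp
      qed
    qed
  qed
  then show ?thesis using p[OF z] z by simp
qed

theorem theorem1p2: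
  fixes u :: "complex \<Rightarrow> complex" and \<theta> :: real
  assumes harmonic: "harmonic_on upper_half_plane u"
    and temperate: "temperate_at_infinity u"
    and boundary: "\<And>x::real. (u \<longlongrightarrow> 0) (at (complex_of_real x) within upper_half_plane)"
    and angle: "0 < \<theta>" "\<theta> < pi" "\<not> (\<exists>q\<in>\<rat>. \<theta> = q * pi)"
    and ray: "((\<lambda>t::real. u (complex_of_real t * exp (\<i> * complex_of_real \<theta>)) / complex_of_real t)
                \<longlongrightarrow> 0) at_top"
  shows "\<forall>z\<in>upper_half_plane. u z = 0"
proof
  fix z assume "z \<in> upper_half_plane"
  then have z: "0 < Im z" by (simp add: upper_half_plane_def)
  note vanish = real_linear_image_vanishes[OF _ _ harmonic temperate boundary angle
      ray[folded cis_conv_exp] z]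
  show "u z = 0"
    using vanish[OF bounded_linear_Re abs_Re_le_cmod] vanish[OF bounded_linear_Im abs_Im_le_cmod]
    by (simp add: complex_eq_iff)
qed

end
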